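(* Let $(x_i)_{i\in\mathbb{N}}$ be a sequence of rationals in $[0,1]$. For every function $\psi\colon\mathbb{B}^{\mathbb{N}}\times\mathbb{N}^{\mathbb{N}}\to\mathbb{N}$ there exist $A\colon\mathbb{N}\to\mathbb{B}$ and $B\colon\mathbb{N}\to\mathbb{N}$ such that for all $n\le\psi(A,B)$, $$Bn<B(n+1)\ \wedge\ x_{Bn}\in I_{[A](n)}.$$
   Context: $\mathbb{B}=\{0,1\}$, $[A](n)=\langle A(0),\dots,A(n-1)\rangle$. For a finite boolean sequence $s$ of length $|s|>0$, $I_s=\big[\sum_{i<|s|}s_i2^{-(i+1)},\ \sum_{i<|s|}s_i2^{-(i+1)}+2^{-|s|}\big]$, and $I_{\langle\rangle}=[0,1]$. *)

theory Defs
  imports Complex_Main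
begin

text \<open>
  The set \<open>{0, 1}\<close> of Boolean values is rendered by the type \<^typ>\<open>bool\<close>, with
  \<^term>\<open>of_bool\<close> as the embedding into the reals.
\<close>

definition initial_segment :: "(nat \<Rightarrow> 'a) \<Rightarrow> nat \<Rightarrow> 'a list" where
  "initial_segment A n = map A [0..<n]"

definition dyadic_interval :: "bool list \<Rightarrow> real set" where
  "dyadic_interval s =
     (if s = [] then {0..1}
      else {(\<Sum>i<length s. of_bool (s ! i) / 2 ^ (i + 1)) ..
            (\<Sum>i<length s. of_bool (s ! i) / 2 ^ (i + 1)) + 1 / 2 ^ length s})"

end

theory Submission
  imports Defs
begin

text \<open>
  The Bolzano-Weierstrass theorem in its full form gives a single pair \<open>(A, B)\<close> that works for all
  \<open>n\<close>, so no property of \<open>\<psi>\<close> matters. Bisection preserves the invariant that infinitely many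
  indices \<open>i\<close> have \<open>x i\<close> in the current dyadic interval; this yields the branch \<open>A\<close>, and the
  infinitude along \<open>A\<close> lets \<open>B\<close> be chosen strictly increasing.
\<close>

lemma initial_segment_Suc: "initial_segment A (Suc n) = initial_segment A n @ [A n]"
  by (simp add: initial_segment_def)

text \<open>For \<open>s = []\<close> the sum is empty and the width is
  \<open>1 / 2 ^ 0 = 1\<close>, so bisection needs no case split.\<close>

lemma dyadic_interval_altdef:
  "dyadic_interval s = {(\<Sum>i<length s. of_bool (s ! i) / 2 ^ (i + 1)) ..
     (\<Sum>i<length s. of_bool (s ! i) / 2 ^ (i + 1)) + 1 / 2 ^ length s}"
  by (simp add: dyadic_interval_def)

text \<open>Appending \<open>False\<close> keeps the left endpoint and appending \<open>True\<close>
  moves it to the midpoint; both halves are closed and meet there.\<close>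

lemma dyadic_interval_bisect:
  "dyadic_interval s \<subseteq> dyadic_interval (s @ [False]) \<union> dyadic_interval (s @ [True])"
proof -
  have "(\<Sum>i<length s. of_bool ((s @ [b]) ! i) / 2 ^ (i + 1)) =
      (\<Sum>i<length s. of_bool (s ! i) / 2 ^ (i + 1) :: real)" for b
    by (intro sum.cong) (auto simp: nth_append)
  then show ?thesis
    by (auto simp: dyadic_interval_altdef field_simps)
qed

lemma bolzano_weierstrass_dyadic:
  fixes x :: "nat \<Rightarrow> real"
  assumes "range x \<subseteq> {0..1}"
  shows "\<exists>A B. strict_mono B \<and> (\<forall>n. x (B n) \<in> dyadic_interval (initial_segment A n))"
proof -
  let ?hits = "\<lambda>s. {i. x i \<in> dyadic_interval s}"
  \<comment> \<open>Dependent choice does not fix the initial value, so the invariant itself carries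
    the clause forcing the start at \<open>[]\<close>.\<close>
  have "\<exists>s. \<forall>n. (infinite (?hits (s n)) \<and> (n = 0 \<longrightarrow> s n = [])) \<and> (\<exists>b. s (Suc n) = s n @ [b])"
  proof (rule dependent_nat_choice)
    have "?hits [] = UNIV"
      using assms by (auto simp: dyadic_interval_def)
    then show "\<exists>s. infinite (?hits s) \<and> (0 = (0::nat) \<longrightarrow> s = [])"
      by auto
  next
    fix s and n :: nat
    assume "infinite (?hits s) \<and> (n = 0 \<longrightarrow> s = [])"
    moreover have "?hits s \<subseteq> ?hits (s @ [False]) \<union> ?hits (s @ [True])"
      using dyadic_interval_bisect[of s] by auto
    ultimately have "infinite (?hits (s @ [False])) \<or> infinite (?hits (s @ [True]))"
      by (meson finite_UnI finite_subset)
    then show "\<exists>s'. (infinite (?hits s') \<and> (Suc n = 0 \<longrightarrow> s' = [])) \<and> (\<exists>b. s' = s @ [b])"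
      by blast
  qed
  then obtain s where inf: "\<And>n. infinite (?hits (s n))" and s0: "s 0 = []"
    and step: "\<And>n. \<exists>b. s (Suc n) = s n @ [b]"
    by blast
  \<comment> \<open>Each step appends exactly one bit, so the branch is read off from the last
    entries.\<close>
  define A where "A n = last (s (Suc n))" for n
  have s_eq: "s n = initial_segment A n" for n
  proof (induction n)
    case 0
    show ?case by (simp add: s0 initial_segment_def)
  next
    case (Suc n)
    have "s (Suc n) = s n @ [A n]"
      using step[of n] by (auto simp: A_def)
    then show ?case
      by (simp add: Suc.IH initial_segment_Suc)
  qed
  have "\<exists>B. \<forall>n. B n \<in> ?hits (s n) \<and> B n < B (Suc n)"
  proof (rule dependent_nat_choice)
    show "\<exists>i. i \<in> ?hits (s 0)"
      using inf[of 0] not_finite_existsD by auto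
    \<comment> \<open>An infinite set of naturals is unbounded, so it has a hit beyond
      \<open>i\<close>.\<close>
    show "\<exists>j. j \<in> ?hits (s (Suc n)) \<and> i < j" for i n
      using inf[of "Suc n"] by (meson finite_nat_set_iff_bounded_le not_le)
  qed
  then show ?thesis
    unfolding s_eq strict_mono_Suc_iff by blast
qed

theorem theorem4p8:
  fixes x :: "nat \<Rightarrow> rat"
    and \<psi> :: "(nat \<Rightarrow> bool) \<times> (nat \<Rightarrow> nat) \<Rightarrow> nat"
  assumes "\<And>i. 0 \<le> x i \<and> x i \<le> 1"
  shows "\<exists>(A :: nat \<Rightarrow> bool) (B :: nat \<Rightarrow> nat).
           \<forall>n \<le> \<psi> (A, B).
             B n < B (n + 1) \<and> of_rat (x (B n)) \<in> dyadic_interval (initial_segment A n)"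
proof -
  have "range (\<lambda>i. of_rat (x i) :: real) \<subseteq> {0..1}"
    using assms by auto
  from bolzano_weierstrass_dyadic[OF this] show ?thesis
    unfolding strict_mono_Suc_iff by auto
qed

end
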